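(* Let $l\ge3$ be an integer and let $$H=\left(\begin{array}{c} I_{l}\otimes\begin{pmatrix}1&0&0&1&1&1\\0&1&0&1&w&w^2\\0&0&1&1&w^2&w\end{pmatrix}\\ \hline \mathbf 1_l\otimes\begin{pmatrix}0&0&0&1&0&w^2\\0&0&0&0&1&w^2\end{pmatrix}\end{array}\right)$$ over $\mathbb F_4$. Then the linear code with parity-check matrix $H$ is an optimal quaternary $[n,k,d]$ $(r,\delta)$-LRC code with $n=6l$, $k=3l-2$, $d=6$, $r=3$, $\delta=4$.
   Context: $\mathbb F_4=\{0,1,w,w^2\}$ with $w^2=w+1$, $w^3=1$; $I_m$ is the $m\times m$ identity matrix, $\mathbf 1_l$ the all-ones row vector of length $l$, and $\otimes$ the Kronecker product. For a linear code $\mathcal C\subseteq\mathbb{F}_q^n$ and $R\subseteq[n]=\{1,\dots,n\}$, $\mathcal C|_R$ is the code obtained by puncturing (deleting) the coordinates outside $R$. An $[n,k,d]$ linear code $\mathcal C$ is an $(r,\delta)$-LRC code if for every $i\in[n]$ there is $R_i\subseteq[n]$ with $i\in R_i$, $|R_i|\le r+\delta-1$, such that $\mathcal C|_{R_i}$ has minimum distance at least $\delta$ (every nonzero word has weight at least $\delta$). Every such code satisfies $d\le n-k+1-(\lceil k/r\rceil-1)(\delta-1)$; it is $d$-optimal if equality holds. An $(r,\delta)$-LRC code is $r$-optimal if it is not an $(r',\delta)$-LRC code for any $1\le r'<r$. "Optimal $(r,\delta)$-LRC code" means an $(r,\delta)$-LRC code that is both $d$-optimal and $r$-optimal, with $d\ge\delta>2$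 and $k>r\ge1$. *)

theory Defs
  imports
    Complex_Main
    "HOL-Library.Cardinality"
    "Jordan_Normal_Form.Matrix"
    "Jordan_Normal_Form.VS_Connect"
    "Jordan_Normal_Form.Matrix_Kernel"
begin

(* Coordinates are indexed from 0, so [n] is rendered as {..<n}. *)

definition hamming_weight :: "'a::zero vec \<Rightarrow> nat" where
  "hamming_weight v = card {i. i < dim_vec v \<and> v $ i \<noteq> 0}"

definition hamming_dist :: "'a vec \<Rightarrow> 'a vec \<Rightarrow> nat" where
  "hamming_dist u v = card {i. i < dim_vec u \<and> u $ i \<noteq> v $ i}"

(* Inf on nat is the least element; the value is only meaningful for codes with at least
   two words. *)
definition min_distance :: "'a vec set \<Rightarrow> nat" where
  "min_distance C = Inf {hamming_dist u v | u v. u \<in> C \<and> v \<in> C \<and> u \<noteq> v}"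

definition linear_code :: "nat \<Rightarrow> 'a::field vec set \<Rightarrow> bool" where
  "linear_code n C \<longleftrightarrow> subspace class_ring C (module_vec TYPE('a) n)"

definition code_dim :: "nat \<Rightarrow> 'a::field vec set \<Rightarrow> nat" where
  "code_dim n C = vectorspace.dim class_ring (module_vec TYPE('a) n\<lparr>carrier := C\<rparr>)"

definition nkd_code :: "nat \<Rightarrow> nat \<Rightarrow> nat \<Rightarrow> 'a::field vec set \<Rightarrow> bool" where
  "nkd_code n k d C \<longleftrightarrow> linear_code n C \<and> code_dim n C = k \<and> min_distance C = d"

definition puncture :: "'a vec set \<Rightarrow> nat set \<Rightarrow> 'a vec set" where
  "puncture C R = (\<lambda>v. vec_of_list (nths (list_of_vec v) R)) ` C"

definition lrc_code :: "nat \<Rightarrow> nat \<Rightarrow> nat \<Rightarrow> 'a::field vec set \<Rightarrow> bool" where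
  "lrc_code n r \<delta> C \<longleftrightarrow> linear_code n C \<and>
     (\<forall>i<n. \<exists>R. R \<subseteq> {..<n} \<and> i \<in> R \<and> card R \<le> r + \<delta> - 1 \<and>
        (\<forall>c\<in>puncture C R. c \<noteq> 0\<^sub>v (dim_vec c) \<longrightarrow> \<delta> \<le> hamming_weight c))"

definition d_optimal :: "nat \<Rightarrow> nat \<Rightarrow> nat \<Rightarrow> nat \<Rightarrow> nat \<Rightarrow> bool" where
  "d_optimal n k d r \<delta> \<longleftrightarrow>
     int d = int n - int k + 1 - (\<lceil>real k / real r\<rceil> - 1) * (int \<delta> - 1)"

definition r_optimal :: "nat \<Rightarrow> nat \<Rightarrow> nat \<Rightarrow> 'a::field vec set \<Rightarrow> bool" where
  "r_optimal n r \<delta> C \<longleftrightarrow> (\<forall>r'. 1 \<le> r' \<and> r' < r \<longrightarrow> \<not> lrc_code n r' \<delta> C)"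

definition optimal_lrc_code ::
  "nat \<Rightarrow> nat \<Rightarrow> nat \<Rightarrow> nat \<Rightarrow> nat \<Rightarrow> 'a::field vec set \<Rightarrow> bool" where
  "optimal_lrc_code n k d r \<delta> C \<longleftrightarrow>
     nkd_code n k d C \<and> lrc_code n r \<delta> C \<and>
     d_optimal n k d r \<delta> \<and> r_optimal n r \<delta> C \<and>
     d \<ge> \<delta> \<and> \<delta> > 2 \<and> k > r \<and> r \<ge> 1"

definition kronecker :: "'a::semiring_1 mat \<Rightarrow> 'a mat \<Rightarrow> 'a mat" where
  "kronecker A B = mat (dim_row A * dim_row B) (dim_col A * dim_col B)
     (\<lambda>(i, j). A $$ (i div dim_row B, j div dim_col B) * B $$ (i mod dim_row B, j mod dim_col B))"

definition ones_row :: "nat \<Rightarrow> 'a::semiring_1 mat" where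
  "ones_row l = mat 1 l (\<lambda>_. 1)"

definition H_mat :: "'a::field \<Rightarrow> nat \<Rightarrow> 'a mat" where
  "H_mat w l =
     kronecker (1\<^sub>m l) (mat_of_rows_list 6
       [[1, 0, 0, 1, 1,   1  ],
        [0, 1, 0, 1, w,   w^2],
        [0, 0, 1, 1, w^2, w  ]])
     @\<^sub>r
     kronecker (ones_row l) (mat_of_rows_list 6
       [[0, 0, 0, 1, 0, w^2],
        [0, 0, 0, 0, 1, w^2]])"

end

theory Submission
  imports Defs
begin

text \<open>
  A codeword is a family of \<open>l\<close> words of the \<open>[6,3,4]\<close> hexacode whose syndromes under the last two rows
  add up to zero. Hence each block of six coordinates is a repair set. A codeword meeting two blocks has
  weight at least 8; one confined to a single block lies in the one-dimensional kernel of the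
  \<open>5 \<times> 6\<close> matrix of that block, whose nonzero words have full weight 6.

  For \<open>r\<close>-optimality let \<open>R\<close> contain coordinate 0 and have at most 5 elements. Since \<open>l \<ge> 3\<close>, one of the
  blocks 1 and 2 meets \<open>R\<close> in at most half of what block 0 leaves over. The hexacode is MDS, so some
  word in block 0 is nonzero at coordinate 0 and vanishes at two further prescribed coordinates; its
  syndrome is cancelled inside the other block, which gives a codeword of weight at most 3 on \<open>R\<close>.
\<close>

subsection \<open>The parity-check matrix\<close>

lemma sum_blocks6:
  fixes f :: "nat \<Rightarrow> 'b::comm_monoid_add"
  shows "(\<Sum>i<6 * l. f i) = (\<Sum>j<l. f (6*j) + f (6*j+1) + f (6*j+2) + f (6*j+3) + f (6*j+4) + f (6*j+5))"
proof (induction l)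
  case (Suc l)
  have eq: "6 * Suc l = Suc (6*l+5)" "6*l+5 = Suc (6*l+4)" "6*l+4 = Suc (6*l+3)" "6*l+3 = Suc (6*l+2)"
      "6*l+2 = Suc (6*l+1)" "6*l+1 = Suc (6*l)"
    by simp_all
  have "(\<Sum>i<6 * Suc l. f i) = (\<Sum>i<6*l. f i) + f (6*l) + f (6*l+1) + f (6*l+2) + f (6*l+3) + f (6*l+4) + f (6*l+5)"
    unfolding eq(1) sum.lessThan_Suc unfolding eq(2) sum.lessThan_Suc unfolding eq(3) sum.lessThan_Suc
    unfolding eq(4) sum.lessThan_Suc unfolding eq(5) sum.lessThan_Suc unfolding eq(6) sum.lessThan_Suc ..
  then show ?case using Suc by (simp add: ac_simps)
qed simp

text \<open>Covers the shapes, such as nested \<open>Suc\<close>, in which simplification leaves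
  offsets inside a block.\<close>

lemma block_arith:
  fixes j :: nat
  shows "Suc (6*j) div 6 = j" "Suc (Suc (6*j)) div 6 = j" "Suc (6*j) mod 6 = 1" "Suc (Suc (6*j)) mod 6 = 2"
    "4 + 6*j = 6*j + 4"
  by presburger+

lemma kronecker_carrier:
  assumes "A \<in> carrier_mat m n" "B \<in> carrier_mat p q"
  shows "kronecker A B \<in> carrier_mat (m * p) (n * q)"
  using assms by (auto simp: kronecker_def)

lemma H_mat_carrier: "H_mat w l \<in> carrier_mat (3*l+2) (6*l)"
proof -
  have "H_mat w l \<in> carrier_mat (l * 3 + 1 * 2) (l * 6)"
    unfolding H_mat_def
    by (intro carrier_append_rows kronecker_carrier) (auto simp: ones_row_def mat_of_rows_list_def intro!: carrier_matI)
  then show ?thesis by (simp add: mult.commute)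
qed

lemma H_mat_local:
  assumes "j < l" "s < 3" "k < 6 * l"
  shows "H_mat w l $$ (3*j+s, k) = (if k div 6 = j then
     [[1, 0, 0, 1, 1, 1], [0, 1, 0, 1, w, w^2], [0, 0, 1, 1, w^2, w]] ! s ! (k mod 6) else 0)"
proof -
  from assms have "3*j+s < 3*l" by linarith
  moreover have "k div 6 < l" using assms by (simp add: less_mult_imp_div_less mult.commute)
  moreover have "(3*j+s) div 3 = j" "(3*j+s) mod 3 = s" using assms by auto
  ultimately show ?thesis using assms
    by (auto simp: H_mat_def kronecker_def ones_row_def append_rows_def mat_of_rows_list_def mult.commute)
qed

lemma H_mat_global:
  assumes "s < 2" "k < 6 * l"
  shows "H_mat w l $$ (3*l+s, k) =
     [[0, 0, 0, 1, 0, w^2], [0, 0, 0, 0, 1, w^2]] ! s ! (k mod 6)"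
proof -
  have "k div 6 < l" using assms by (simp add: less_mult_imp_div_less mult.commute)
  then show ?thesis using assms
    by (auto simp: H_mat_def kronecker_def ones_row_def append_rows_def mat_of_rows_list_def mult.commute)
qed

lemma H_mat_mult_nth:
  assumes "dim_vec v = 6 * l" "i < 3*l+2"
  shows "(H_mat w l *\<^sub>v v) $ i = (\<Sum>k<6*l. H_mat w l $$ (i, k) * v $ k)"
  using assms H_mat_carrier[of w l] by (auto simp: scalar_prod_def lessThan_atLeast0)

lemma H_mat_mult_local:
  fixes v :: "'a::field vec"
  assumes v: "dim_vec v = 6 * l" and j: "j < l" and s: "s < 3"
  shows "(H_mat w l *\<^sub>v v) $ (3*j+s) = v $ (6*j+s) + v $ (6*j+3) + [1, w, w^2] ! s * v $ (6*j+4)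
      + [1, w^2, w] ! s * v $ (6*j+5)"
proof -
  have "(H_mat w l *\<^sub>v v) $ (3*j+s) = (\<Sum>k<6*l. H_mat w l $$ (3*j+s, k) * v $ k)"
    by (rule H_mat_mult_nth) (use assms in auto)
  also have "\<dots> = (\<Sum>k<6*l. (if k div 6 = j then
     [[1, 0, 0, 1, 1, 1], [0, 1, 0, 1, w, w^2], [0, 0, 1, 1, w^2, w]] ! s ! (k mod 6) else 0) * v $ k)"
    by (intro sum.cong refl) (simp add: H_mat_local[OF j s])
  \<comment> \<open>Grouped by blocks of six columns, only block \<open>j\<close> meets row
    \<open>3*j+s\<close>.\<close>
  also have "\<dots> = (\<Sum>j'<l. if j' = j then v $ (6*j+s) + v $ (6*j+3) + [1, w, w^2] ! s * v $ (6*j+4)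
      + [1, w^2, w] ! s * v $ (6*j+5) else 0)"
    unfolding sum_blocks6
  proof (intro sum.cong refl, goal_cases)
    case (1 j')
    have "s = 0 \<or> s = 1 \<or> s = 2" using s by auto
    then show ?case by (cases "j' = j"; elim disjE) (simp_all add: block_arith split del: if_split)
  qed
  finally show ?thesis using j by simp
qed

lemma H_mat_mult_global:
  fixes v :: "'a::field vec"
  assumes v: "dim_vec v = 6 * l" and s: "s < 2"
  shows "(H_mat w l *\<^sub>v v) $ (3*l+s) = (\<Sum>j<l. v $ (6*j+3+s) + w^2 * v $ (6*j+5))"
proof -
  have "(H_mat w l *\<^sub>v v) $ (3*l+s) = (\<Sum>k<6*l. H_mat w l $$ (3*l+s, k) * v $ k)"
    by (rule H_mat_mult_nth) (use assms in auto)
  also have "\<dots> = (\<Sum>k<6*l. [[0, 0, 0, 1, 0, w^2], [0, 0, 0, 0, 1, w^2]] ! s ! (k mod 6) * v $ k)"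
    by (intro sum.cong refl) (simp add: H_mat_global[OF s])
  also have "\<dots> = (\<Sum>j<l. v $ (6*j+3+s) + w^2 * v $ (6*j+5))"
    unfolding sum_blocks6
  proof (intro sum.cong refl, goal_cases)
    case (1 j')
    have "s = 0 \<or> s = 1" using s by auto
    then show ?case by (elim disjE) (simp_all add: block_arith)
  qed
  finally show ?thesis .
qed

section \<open>Full row rank and the dimension of the code\<close>

lemma H_mat_surj:
  fixes y :: "'a::field vec"
  assumes y: "y \<in> carrier_vec (3*l+2)" and l: "l > 0"
  shows "\<exists>v \<in> carrier_vec (6*l). H_mat w l *\<^sub>v v = y"
proof -
  \<comment> \<open>Block 0 alone produces the two global syndromes: its columns 3 and 4, counted
    from 0, carry unit vectors in the global rows. The identity columns 0 to 2 of each block then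
    correct the local syndromes without touching the global ones.\<close>
  define a where "a j = (if j = 0 then y $ (3*l) else 0)" for j :: nat
  define b where "b j = (if j = 0 then y $ (3*l+1) else 0)" for j :: nat
  define v where "v = vec (6*l) (\<lambda>i. let j = i div 6 in
     [y $ (3*j) - a j - b j, y $ (3*j+1) - a j - w * b j, y $ (3*j+2) - a j - w^2 * b j, a j, b j, 0] ! (i mod 6))"
  have v: "v $ (6*j+t) = [y $ (3*j) - a j - b j, y $ (3*j+1) - a j - w * b j, y $ (3*j+2) - a j - w^2 * b j, a j, b j, 0] ! t"
    if "j < l" "t < 6" for j t
    using that by (auto simp: v_def)
  have d: "dim_vec v = 6*l" by (simp add: v_def)
  have "(H_mat w l *\<^sub>v v) $ i = y $ i" if i: "i < 3*l+2" for i
  proof (cases "i < 3*l")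
    case True
    define j s where "j = i div 3" and "s = i mod 3"
    have js: "i = 3*j+s" "j < l" "s < 3" using True by (auto simp: j_def s_def)
    have "s = 0 \<or> s = 1 \<or> s = 2" using js by auto
    then show ?thesis unfolding js(1) H_mat_mult_local[OF d js(2,3)]
      using js(2) v[of j 0] v[of j 1] v[of j 2] v[of j 3] v[of j 4] v[of j 5] by (elim disjE) simp_all
  next
    case False
    define s where "s = i - 3*l"
    have s: "i = 3*l+s" "s < 2" using False i by (auto simp: s_def)
    have "(\<Sum>j<l. v $ (6*j+3+s) + w^2 * v $ (6*j+5)) = (\<Sum>j<l. if j = 0 then y $ (3*l+s) else 0)"
    proof (intro sum.cong refl, goal_cases)
      case (1 j)
      have "s = 0 \<or> s = 1" using s by auto
      then show ?case using 1 v[of j 3] v[of j 4] v[of j 5] by (auto simp: a_def b_def add.commute)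
    qed
    also have "\<dots> = y $ (3*l+s)" using l by simp
    finally show ?thesis unfolding s(1) H_mat_mult_global[OF d s(2)] .
  qed
  then have "H_mat w l *\<^sub>v v = y"
    using y H_mat_carrier[of w l] by (intro eq_vecI) auto
  then show ?thesis using d by (intro bexI[of _ v]) (auto intro: carrier_vecI)
qed

text \<open>Rank-nullity for a parity-check matrix of full row rank. With \<open>3*l+2\<close> rows
  and \<open>6*l\<close> columns it yields the dimension \<open>3*l-2\<close>.\<close>

lemma (in vec_space) mat_kernel_dim_surj:
  fixes A :: "'a mat"
  assumes A: "A \<in> carrier_mat m n"
    and surj: "\<And>y. y \<in> carrier_vec m \<Longrightarrow> \<exists>v \<in> carrier_vec n. A *\<^sub>v v = y"
  shows "vectorspace.dim class_ring (V\<lparr>carrier := mat_kernel A\<rparr>) = n - m"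
    and "subspace class_ring (mat_kernel A) V"
proof -
  interpret W: vec_space "TYPE('a)" m .
  interpret T: linear_map class_ring V W.V "\<lambda>v. A *\<^sub>v v"
    by (intro linear_map.intro mod_hom.intro mod_hom_axioms.intro vectorspace_axioms W.vectorspace_axioms
      module_axioms W.module_axioms)
     (use A in \<open>auto simp: LinearCombinations.module_hom_def module_vec_simps mult_add_distrib_mat_vec mult_mat_vec\<close>)
  have ker: "T.ker = mat_kernel A"
    using A by (auto simp: T.ker_def mat_kernel module_vec_simps)
  have im: "T.im = carrier W.V"
    using A surj by (fastforce simp: T.im_def image_def module_vec_simps)
  have "vectorspace.dim class_ring (W.vs T.im) + vectorspace.dim class_ring (vs T.ker) = dim"
    by (rule T.rank_nullity) simp
  then have "m + vectorspace.dim class_ring (vs (mat_kernel A)) = n"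
    unfolding ker im using dim_is_n W.dim_is_n by (simp add: module_vec_def)
  then show "vectorspace.dim class_ring (V\<lparr>carrier := mat_kernel A\<rparr>) = n - m" by simp
  show "subspace class_ring (mat_kernel A) V"
    using T.kerT_is_subspace unfolding ker .
qed

subsection \<open>Linear codes\<close>

lemma length_filter_nths:
  "length (filter P (nths xs R)) = card {i \<in> R. i < length xs \<and> P (xs ! i)}"
proof -
  have "filter P (nths xs R) = nths xs {i \<in> R. i < length xs \<and> P (xs ! i)}"
  \<comment> \<open>Induction from the right end, since appending an element leaves the earlier
    indices unshifted.\<close>
  proof (induction xs rule: rev_induct)
    case (snoc x xs)
    have *: "nths xs {i \<in> R. i < Suc (length xs) \<and> P ((xs @ [x]) ! i)}
        = nths xs {i \<in> R. i < length xs \<and> P (xs ! i)}"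
      unfolding nths_def by (intro arg_cong[of _ _ "map fst"] filter_cong refl)
        (auto simp: set_zip nth_append)
    show ?case by (auto simp: nths_append * snoc.IH)
  qed simp
  then have "length (filter P (nths xs R)) = card {i. i < length xs \<and> i \<in> {i \<in> R. i < length xs \<and> P (xs ! i)}}"
    by (simp only: length_nths)
  also have "{i. i < length xs \<and> i \<in> {i \<in> R. i < length xs \<and> P (xs ! i)}} = {i \<in> R. i < length xs \<and> P (xs ! i)}"
    by auto
  finally show ?thesis .
qed

text \<open>Puncturing renumbers the surviving coordinates; this allows weights to be counted in the
  original numbering.\<close>

lemma hamming_weight_puncture:
  "hamming_weight (vec_of_list (nths (list_of_vec v) R)) = card {i \<in> R. i < dim_vec v \<and> v $ i \<noteq> 0}"
proof -
  have "hamming_weight (vec_of_list xs) = length (filter (\<lambda>x. x \<noteq> 0) xs)" for xs :: "'a list"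
    unfolding hamming_weight_def length_filter_conv_card by (simp add: vec_of_list_index)
  then show ?thesis
    by (simp add: length_filter_nths list_of_vec_index cong: conj_cong)
qed

lemma hamming_weight_eq_0_iff: "hamming_weight v = 0 \<longleftrightarrow> v = 0\<^sub>v (dim_vec v)"
  by (auto simp: hamming_weight_def vec_eq_iff)

text \<open>Eliminates \<open>puncture\<close>: a punctured word is zero exactly when its weight is
  zero, that is, when the word vanishes on \<open>R\<close>.\<close>

lemma lrc_code_alt:
  "lrc_code n r \<delta> C \<longleftrightarrow> linear_code n C \<and>
     (\<forall>i<n. \<exists>R. R \<subseteq> {..<n} \<and> i \<in> R \<and> card R \<le> r + \<delta> - 1 \<and>
        (\<forall>v\<in>C. (\<exists>i\<in>R. v $ i \<noteq> 0) \<longrightarrow> \<delta> \<le> card {i \<in> R. v $ i \<noteq> 0}))"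
proof (cases "linear_code n C")
  case True
  then have "C \<subseteq> carrier_vec n"
    using submodule.subset[of class_ring C "module_vec TYPE('a) n"]
    by (simp add: linear_code_def subspace_def module_vec_simps)
  then have dim: "dim_vec v = n" if "v \<in> C" for v
    using that by auto
  have eq: "(\<forall>c\<in>puncture C R. c \<noteq> 0\<^sub>v (dim_vec c) \<longrightarrow> \<delta> \<le> hamming_weight c) \<longleftrightarrow>
      (\<forall>v\<in>C. (\<exists>i\<in>R. v $ i \<noteq> 0) \<longrightarrow> \<delta> \<le> card {i \<in> R. v $ i \<noteq> 0})"
    if R: "R \<subseteq> {..<n}" for R
  proof -
    have "finite R" using R finite_subset by blast
    have 1: "{i \<in> R. i < dim_vec v \<and> v $ i \<noteq> 0} = {i \<in> R. v $ i \<noteq> 0}" if "v \<in> C" for v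
      using dim[OF that] R by auto
    have 2: "card {i \<in> R. v $ i \<noteq> 0} \<noteq> 0 \<longleftrightarrow> (\<exists>i\<in>R. v $ i \<noteq> 0)" for v :: "'a vec"
      using \<open>finite R\<close> by auto
    show ?thesis
      unfolding puncture_def ball_simps hamming_weight_eq_0_iff[symmetric] hamming_weight_puncture
      by (intro ball_cong refl) (simp only: 1 2)
  qed
  show ?thesis unfolding lrc_code_def by (intro conj_cong refl all_cong ex_cong1 eq)
qed (simp add: lrc_code_def)

text \<open>The distance of two codewords is the weight of their difference, again a codeword. The
  witness \<open>v0\<close> shows that the bound is attained, so the infimum is a minimum.\<close>

lemma min_distance_linear:
  assumes C: "linear_code n C"
    and lower: "\<And>v. v \<in> C \<Longrightarrow> v \<noteq> 0\<^sub>v n \<Longrightarrow> d \<le> hamming_weight v"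
    and v0: "v0 \<in> C" "v0 \<noteq> 0\<^sub>v n" "hamming_weight v0 = d"
  shows "min_distance C = d"
proof -
  interpret C: submodule class_ring C "module_vec TYPE('a) n"
    using C by (simp add: linear_code_def subspace_def)
  have dim: "u \<in> carrier_vec n" if "u \<in> C" for u
    using C.subset that by (auto simp: module_vec_simps)
  have zero: "0\<^sub>v n \<in> C" using C.zero_closed by (simp add: module_vec_simps)
  have diff: "u - v \<in> C" if "u \<in> C" "v \<in> C" for u v
  proof -
    \<comment> \<open>A submodule offers closure under sums and scalar multiples, so subtraction is
      expressed by the scalar -1.\<close>
    have "(- 1) \<cdot>\<^sub>v v \<in> C" using C.smult_closed[of "- 1" v] that
      by (simp add: module_vec_simps class_ring_simps)
    then have "u + (- 1) \<cdot>\<^sub>v v \<in> C" using C.m_closed[of u "(- 1) \<cdot>\<^sub>v v"] that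
      by (simp add: module_vec_simps)
    moreover have "u + (- 1) \<cdot>\<^sub>v v = u - v" using dim[OF that(1)] dim[OF that(2)] by auto
    ultimately show ?thesis by simp
  qed
  have dist: "hamming_dist u v = hamming_weight (u - v)" if "u \<in> C" "v \<in> C" for u v
    using dim[OF that(1)] dim[OF that(2)]
    by (auto simp: hamming_dist_def hamming_weight_def intro!: arg_cong[of _ _ card])
  show ?thesis unfolding min_distance_def
  proof (rule cInf_eq_minimum)
    have "hamming_dist v0 (0\<^sub>v n) = d"
      using v0 dim[OF v0(1)] by (simp add: dist[OF v0(1) zero])
    then show "d \<in> {hamming_dist u v |u v. u \<in> C \<and> v \<in> C \<and> u \<noteq> v}"
      using v0 zero by blast
  next
    fix x assume "x \<in> {hamming_dist u v |u v. u \<in> C \<and> v \<in> C \<and> u \<noteq> v}"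
    then obtain u v where x: "x = hamming_dist u v" and uv: "u \<in> C" "v \<in> C" "u \<noteq> v" by auto
    have "u - v \<noteq> 0\<^sub>v n"
    proof
      assume eq: "u - v = 0\<^sub>v n"
      have "u $ i = v $ i" if "i < n" for i
        using arg_cong[OF eq, of "\<lambda>x. x $ i"] that dim[OF uv(1)] dim[OF uv(2)] by simp
      then have "u = v" using dim[OF uv(1)] dim[OF uv(2)] by (intro eq_vecI) auto
      with uv show False by simp
    qed
    then show "d \<le> x" unfolding x dist[OF uv(1,2)] by (intro lower diff uv)
  qed
qed

subsection \<open>The hexacode\<close>

text \<open>The kernel of the \<open>3 \<times> 6\<close> block of \<^const>\<open>H_mat\<close>, parametrized by its last three coordinates; signs
  are dropped because the characteristic is 2.\<close>

definition hexacode_word :: "'a::field \<Rightarrow> 'a \<Rightarrow> 'a \<Rightarrow> 'a \<Rightarrow> nat \<Rightarrow> 'a" where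
  "hexacode_word w a b c t = [a + b + c, a + w * b + w^2 * c, a + w^2 * b + w * c, a, b, c] ! t"

locale quaternary_field =
  fixes w :: "'a::field"
  assumes card4: "CARD('a) = 4"
    and w_sq: "w^2 = w + 1"
begin

text \<open>Translation by 1 permutes the field, so summing all elements gives \<open>4 = 0\<close>.\<close>

lemma two_eq_0: "(2::'a) = 0"
proof -
  have "(\<Sum>x\<in>UNIV. x) = (\<Sum>x\<in>UNIV. x + (1::'a))"
    by (rule sum.reindex_bij_witness[of _ "\<lambda>x. x + 1" "\<lambda>x. x - 1"]) auto
  also have "\<dots> = (\<Sum>x\<in>UNIV. x) + of_nat CARD('a)"
    by (simp add: sum.distrib)
  finally have "(2::'a) * 2 = 0" by (simp add: card4)
  then show ?thesis by (simp only: mult_eq_0_iff) blast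
qed

lemma add_self: "x + x = (0::'a)"
  by (metis two_eq_0 mult_2 mult_zero_left)

lemma add_self_left: "x + (x + y) = (y::'a)"
  by (simp add: add_self flip: add.assoc)

lemma ww: "w * w = w + 1"
  using w_sq by (simp add: power2_eq_square)

lemma www: "w * (w * x) = w * x + x"
  by (simp add: ww algebra_simps flip: mult.assoc)

lemma add_eq_0: "x + y = 0 \<longleftrightarrow> x = (y::'a)"
  by (metis add_self add_left_cancel)

text \<open>Each equality would make \<open>w\<close> equal to 0 or 1, and then
  \<open>w^2 = w + 1\<close> collapses to 0 = 1, using characteristic 2.\<close>

lemma w_nonzero: "w \<noteq> 0" "w \<noteq> 1" "w + 1 \<noteq> 0" "1 + w \<noteq> 0"
  using w_sq by (auto simp: add_eq_0 two_eq_0)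

lemma elems: "x \<in> {0, 1, w, w + 1}"
proof -
  have "card {0, 1, w, w + 1} = 4" using w_nonzero by auto
  \<comment> \<open>An infinite type has \<open>card\<close> equal to 0, not 4.\<close>
  moreover have "finite (UNIV :: 'a set)" using card4 card.infinite by fastforce
  ultimately have "{0, 1, w, w + 1} = (UNIV :: 'a set)"
    using card4 by (intro card_subset_eq) auto
  then show ?thesis by auto
qed

text \<open>A rewrite system that lowers powers of \<open>w\<close> and cancels repeated summands,
  so that concrete identities in the field are decided by simplification.\<close>

lemmas F4 = ww www add_self add_self_left distrib_left distrib_right power2_eq_square ac_simps

text \<open>A sum of six indicators can be evaluated term by term once \<open>a\<close>,
  \<open>b\<close>, \<open>c\<close> are concrete.\<close>

lemma hex_weight_sum:
  "card {t. t < 6 \<and> hexacode_word w a b c t \<noteq> 0} = (\<Sum>t<6. of_bool (hexacode_word w a b c t \<noteq> 0))"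
  by (simp add: Int_def lessThan_def)

text \<open>The minimum distance of the hexacode, by exhaustion over the triples of field
  elements.\<close>

lemma hex_weight:
  assumes "a \<noteq> 0 \<or> b \<noteq> 0 \<or> c \<noteq> 0"
  shows "4 \<le> card {t. t < 6 \<and> hexacode_word w a b c t \<noteq> 0}"
  using elems[of a] elems[of b] elems[of c] assms unfolding hex_weight_sum insert_iff empty_iff simp_thms
  by (elim disjE) (simp_all add: hexacode_word_def numeral_eq_Suc w_nonzero F4)

text \<open>The choice \<open>a = b = w^2*c\<close> makes both global syndromes of the block vanish.
  The word is then \<open>c\<close> times (1, 1, w^2, w^2, w^2, 1), because w^3 = 1.\<close>

lemma hex_weight_ker:
  assumes "c \<noteq> 0"
  shows "card {t. t < 6 \<and> hexacode_word w (w^2*c) (w^2*c) c t \<noteq> 0} = 6"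
  using elems[of c] assms unfolding hex_weight_sum insert_iff empty_iff simp_thms
  by (elim disjE) (simp_all add: hexacode_word_def numeral_eq_Suc w_nonzero F4)

end

subsection \<open>Codewords\<close>

lemma all_less_6: "(\<forall>t<6. P t) \<longleftrightarrow> P 0 \<and> P 1 \<and> P 2 \<and> P 3 \<and> P 4 \<and> P (5::nat)"
  by (simp add: numeral_eq_Suc All_less_Suc conj_ac)

lemma all_less_3: "(\<forall>t<3. P t) \<longleftrightarrow> P 0 \<and> P 1 \<and> P (2::nat)"
  by (simp add: numeral_eq_Suc All_less_Suc conj_ac)

lemma mem_kernel_H_mat:
  assumes "dim_vec v = 6 * l"
  shows "v \<in> mat_kernel (H_mat w l) \<longleftrightarrow>
    (\<forall>j<l. \<forall>s<3. v $ (6*j+s) + v $ (6*j+3) + [1, w, w^2] ! s * v $ (6*j+4) + [1, w^2, w] ! s * v $ (6*j+5) = 0) \<and>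
    (\<forall>s<2. (\<Sum>j<l. v $ (6*j+3+s) + w^2 * v $ (6*j+5)) = 0)" (is "_ \<longleftrightarrow> ?rhs")
proof -
  let ?u = "H_mat w l *\<^sub>v v"
  have "v \<in> mat_kernel (H_mat w l) \<longleftrightarrow> (\<forall>i<3*l+2. ?u $ i = 0)"
    using carrier_vecI[OF assms] carrier_matD[OF H_mat_carrier[of w l]]
    unfolding mat_kernel[OF H_mat_carrier] mem_Collect_eq by (simp add: vec_eq_iff)
  \<comment> \<open>The first \<open>3*l\<close> rows are the local checks, three per block; the
    last two are the global checks.\<close>
  also have "\<dots> \<longleftrightarrow> (\<forall>j<l. \<forall>s<3. ?u $ (3*j+s) = 0) \<and> (\<forall>s<2. ?u $ (3*l+s) = 0)"
  proof safe
    fix i assume *: "\<forall>j<l. \<forall>s<3. ?u $ (3*j+s) = 0" "\<forall>s<2. ?u $ (3*l+s) = 0" "i < 3*l+2"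
    show "?u $ i = 0"
    proof (cases "i < 3*l")
      case True
      then have "i div 3 < l" "i mod 3 < 3" by auto
      with *(1) have "?u $ (3 * (i div 3) + i mod 3) = 0" by blast
      then show ?thesis by simp
    next
      case False
      with *(2,3) have "?u $ (3*l + (i - 3*l)) = 0" by (metis add.commute le_add_diff_inverse2 less_diff_conv2 not_less)
      with False show ?thesis by simp
    qed
  qed auto
  also have "\<dots> \<longleftrightarrow> ?rhs"
    using H_mat_mult_local[OF assms] H_mat_mult_global[OF assms] by simp
  finally show ?thesis .
qed

lemma card_block:
  "card {i \<in> {6*j..<6*j+6}. P i} = card {t. t < 6 \<and> P (6*j+t)}"
  for j :: nat
proof -
  have "{i \<in> {6*j..<6*j+6}. P i} = (+) (6*j) ` {t. t < 6 \<and> P (6*j+t)}"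
  proof (intro equalityI subsetI)
    fix i assume "i \<in> {i \<in> {6*j..<6*j+6}. P i}"
    then show "i \<in> (+) (6*j) ` {t. t < 6 \<and> P (6*j+t)}"
      by (intro image_eqI[of _ _ "i - 6*j"]) auto
  qed auto
  then show ?thesis by (simp add: card_image)
qed

context quaternary_field
begin

text \<open>The three local checks, solved for the first three coordinates of the block; moving
  terms across the equation costs no sign in characteristic 2.\<close>

lemma kernel_block:
  assumes v: "v \<in> mat_kernel (H_mat w l)" and j: "j < l" and t: "t < 6"
  shows "v $ (6*j+t) = hexacode_word w (v $ (6*j+3)) (v $ (6*j+4)) (v $ (6*j+5)) t"
proof -
  have "dim_vec v = 6*l" using v mat_kernelD(1)[OF H_mat_carrier v] by auto
  then have "\<forall>s<3. v $ (6*j+s) + v $ (6*j+3) + [1, w, w^2] ! s * v $ (6*j+4) + [1, w^2, w] ! s * v $ (6*j+5) = 0"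
    using mem_kernel_H_mat v j by blast
  then have "\<forall>t<6. v $ (6*j+t) = hexacode_word w (v $ (6*j+3)) (v $ (6*j+4)) (v $ (6*j+5)) t"
    unfolding all_less_3 all_less_6 by (simp add: hexacode_word_def add.assoc add_eq_0)
  then show ?thesis using t by blast
qed

lemma kernel_block_weight:
  assumes v: "v \<in> mat_kernel (H_mat w l)" and j: "j < l"
  shows "card {i \<in> {6*j..<6*j+6}. v $ i \<noteq> 0}
    = card {t. t < 6 \<and> hexacode_word w (v $ (6*j+3)) (v $ (6*j+4)) (v $ (6*j+5)) t \<noteq> 0}"
  unfolding card_block using kernel_block[OF assms] by (metis (no_types, lifting))

lemma kernel_block_nonzero:
  assumes v: "v \<in> mat_kernel (H_mat w l)" and j: "j < l"
    and i: "i \<in> {6*j..<6*j+6}" "v $ i \<noteq> 0"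
  shows "v $ (6*j+3) \<noteq> 0 \<or> v $ (6*j+4) \<noteq> 0 \<or> v $ (6*j+5) \<noteq> 0"
proof (rule ccontr)
  assume "\<not> ?thesis"
  then have 0: "v $ (6*j+3) = 0" "v $ (6*j+4) = 0" "v $ (6*j+5) = 0" by auto
  have "\<forall>t<6. hexacode_word w 0 0 0 t = 0" unfolding all_less_6 by (simp add: hexacode_word_def)
  then have "v $ (6*j+(i-6*j)) = 0"
    using kernel_block[OF v j, of "i - 6*j"] i(1) unfolding 0 by auto
  with i show False by auto
qed

lemma kernel_block_weight_ge:
  assumes "v \<in> mat_kernel (H_mat w l)" "j < l" "i \<in> {6*j..<6*j+6}" "v $ i \<noteq> 0"
  shows "4 \<le> card {i \<in> {6*j..<6*j+6}. v $ i \<noteq> 0}"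
  unfolding kernel_block_weight[OF assms(1,2)]
  by (rule hex_weight[OF kernel_block_nonzero[OF assms]])

section \<open>Minimum weight of the code\<close>

lemma kernel_weight_ge:
  assumes v: "v \<in> mat_kernel (H_mat w l)" and nz: "v \<noteq> 0\<^sub>v (6*l)"
  shows "6 \<le> hamming_weight v"
proof -
  have d: "dim_vec v = 6*l" using v mat_kernelD(1)[OF H_mat_carrier v] by auto
  from nz d obtain i where i: "i < 6*l" "v $ i \<noteq> 0" by (auto simp: vec_eq_iff)
  define B where "B j = {i \<in> {6*j..<6*j+6}. v $ i \<noteq> 0}" for j
  define j where "j = i div 6"
  have j: "j < l" "i \<in> {6*j..<6*j+6}" using i by (auto simp: j_def)
  have fin: "finite {i. i < dim_vec v \<and> v $ i \<noteq> 0}" by simp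
  have sub: "B k \<subseteq> {i. i < dim_vec v \<and> v $ i \<noteq> 0}" if "k < l" for k
    using that d by (auto simp: B_def)
  show ?thesis
  proof (cases "\<exists>k i'. k < l \<and> k \<noteq> j \<and> i' \<in> {6*k..<6*k+6} \<and> v $ i' \<noteq> 0")
    case True
    then obtain k i' where k: "k < l" "k \<noteq> j" "i' \<in> {6*k..<6*k+6}" "v $ i' \<noteq> 0" by blast
    have "B j \<inter> B k = {}" using k(2) by (auto simp: B_def)
    then have "card (B j) + card (B k) = card (B j \<union> B k)"
      by (subst card_Un_disjoint) (auto simp: B_def)
    also have "\<dots> \<le> hamming_weight v"
      unfolding hamming_weight_def using sub j k by (intro card_mono fin) auto
    finally show ?thesis
      using kernel_block_weight_ge[OF v j i(2)] kernel_block_weight_ge[OF v k(1,3,4)]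
      unfolding B_def by linarith
  next
    case False
    then have 0: "v $ (6*k+t) = 0" if "k < l" "k \<noteq> j" "t < 6" for k t
      using that by fastforce
    \<comment> \<open>All other blocks are zero, so each global sum reduces to its term at
      \<open>j\<close>. This places the block in the one-dimensional kernel treated by
      \<open>hex_weight_ker\<close>.\<close>
    have "v $ (6*j+3+s) + w^2 * v $ (6*j+5) = 0" if s: "s < 2" for s
    proof -
      have "0 = (\<Sum>k<l. v $ (6*k+3+s) + w^2 * v $ (6*k+5))"
        using mem_kernel_H_mat[OF d] v s by force
      also have "\<dots> = (\<Sum>k\<in>{j}. v $ (6*k+3+s) + w^2 * v $ (6*k+5))"
        using j(1) s 0[of _ "3+s"] 0[of _ 5] by (intro sum.mono_neutral_right) (auto simp: add.assoc)
      finally show ?thesis by simp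
    qed
    from this[of 0] this[of 1] have ab: "v $ (6*j+3) = w^2 * v $ (6*j+5)" "v $ (6*j+4) = w^2 * v $ (6*j+5)"
      by (simp_all add: add_eq_0 block_arith)
    with kernel_block_nonzero[OF v j i(2)] have "v $ (6*j+5) \<noteq> 0" by auto
    then have "card (B j) = 6"
      unfolding B_def kernel_block_weight[OF v j(1)] ab by (rule hex_weight_ker)
    moreover have "card (B j) \<le> hamming_weight v"
      unfolding hamming_weight_def using sub j by (intro card_mono fin) auto
    ultimately show ?thesis by simp
  qed
qed

text \<open>Prescribing the last three coordinates of each block makes the local checks hold
  automatically, leaving only the two global sums to be arranged.\<close>

definition word :: "nat \<Rightarrow> (nat \<Rightarrow> 'a) \<Rightarrow> (nat \<Rightarrow> 'a) \<Rightarrow> (nat \<Rightarrow> 'a) \<Rightarrow> 'a vec" where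
  "word l a b c = vec (6*l) (\<lambda>i. hexacode_word w (a (i div 6)) (b (i div 6)) (c (i div 6)) (i mod 6))"

lemma dim_word [simp]: "dim_vec (word l a b c) = 6*l"
  by (simp add: word_def)

lemma word_nth: "j < l \<Longrightarrow> t < 6 \<Longrightarrow> word l a b c $ (6*j+t) = hexacode_word w (a j) (b j) (c j) t"
  by (simp add: word_def)

lemma word_in_kernel:
  assumes "(\<Sum>j<l. a j + w^2 * c j) = 0" "(\<Sum>j<l. b j + w^2 * c j) = 0"
  shows "word l a b c \<in> mat_kernel (H_mat w l)"
  unfolding mem_kernel_H_mat[OF dim_word]
proof (intro conjI allI impI)
  fix j s :: nat assume j: "j < l" and s: "s < 3"
  then have "s = 0 \<or> s = 1 \<or> s = 2" by auto
  then show "word l a b c $ (6*j+s) + word l a b c $ (6*j+3) + [1, w, w^2] ! s * word l a b c $ (6*j+4)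
      + [1, w^2, w] ! s * word l a b c $ (6*j+5) = 0"
    using s by (elim disjE) (simp_all only: word_nth[OF j], simp_all add: hexacode_word_def add.assoc add_eq_0 two_eq_0)
next
  fix s :: nat assume s: "s < 2"
  then have "s = 0 \<or> s = 1" by auto
  then have "(\<Sum>j<l. word l a b c $ (6*j+(3+s)) + w^2 * word l a b c $ (6*j+5)) = 0"
    using s assms by (elim disjE) (simp_all add: word_nth hexacode_word_def)
  then show "(\<Sum>j<l. word l a b c $ (6*j+3+s) + w^2 * word l a b c $ (6*j+5)) = 0"
    by (simp add: add.assoc)
qed

lemma ex_word_weight_6:
  assumes l: "l > 0"
  shows "\<exists>v \<in> mat_kernel (H_mat w l). hamming_weight v = 6"
proof
  \<comment> \<open>Block 0 receives the full-weight kernel word with parameter 1, every other block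
    the zero word.\<close>
  define c :: "nat \<Rightarrow> 'a" where "c j = of_bool (j = 0)" for j
  let ?v = "word l (\<lambda>j. w^2 * c j) (\<lambda>j. w^2 * c j) c"
  show v: "?v \<in> mat_kernel (H_mat w l)"
    by (rule word_in_kernel) (simp_all add: add_self)
  have "\<forall>t<6. hexacode_word w 0 0 0 t = 0" unfolding all_less_6 by (simp add: hexacode_word_def)
  then have "?v $ i = 0" if "i < 6*l" "i \<ge> 6" for i
    using that by (simp add: word_def c_def)
  then have "hamming_weight ?v = card {i \<in> {6*0..<6*0+6}. ?v $ i \<noteq> 0}"
    unfolding hamming_weight_def using l by (intro arg_cong[of _ _ card]) force
  also have "\<dots> = 6"
    unfolding kernel_block_weight[OF v l] using l word_nth[OF l, of 3] word_nth[OF l, of 4] word_nth[OF l, of 5]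
      hex_weight_ker[of 1] by (simp add: hexacode_word_def c_def)
  finally show "hamming_weight ?v = 6" .
qed

section \<open>Codewords that rule out smaller locality\<close>

lemma two_block_word:
  assumes m: "0 < m" "m < l"
  shows "\<exists>v \<in> mat_kernel (H_mat w l). (\<forall>t<6. v $ t = hexacode_word w a b c t) \<and>
    (\<forall>i<6*l. i \<notin> {0..<6} \<union> {6*m..<6*m+6} \<longrightarrow> v $ i = 0)"
proof (intro bexI conjI allI impI)
  \<comment> \<open>Block 0 has global syndrome \<open>(a + w^2*c, b + w^2*c)\<close>. Block
    \<open>m\<close> reproduces it with third parameter 0, and the two copies cancel in
    characteristic 2.\<close>
  define a' where "a' j = (if j = 0 then a else if j = m then a + w^2 * c else 0)" for j
  define b' where "b' j = (if j = 0 then b else if j = m then b + w^2 * c else 0)" for j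
  define c' where "c' j = (if j = 0 then c else 0)" for j :: nat
  let ?v = "word l a' b' c'"
  have "(\<Sum>j<l. f j) = f 0 + f m" if "\<And>j. j \<noteq> 0 \<Longrightarrow> j \<noteq> m \<Longrightarrow> f j = 0" for f :: "nat \<Rightarrow> 'a"
  proof -
    have "(\<Sum>j<l. f j) = (\<Sum>j\<in>{0, m}. f j)"
      using m that by (intro sum.mono_neutral_right) auto
    then show ?thesis using m by simp
  qed
  then show "?v \<in> mat_kernel (H_mat w l)"
    using m by (intro word_in_kernel) (simp_all add: a'_def b'_def c'_def add_self two_eq_0)
  show "?v $ t = hexacode_word w a b c t" if "t < 6" for t
    using word_nth[of 0 l t] m that by (simp add: a'_def b'_def c'_def)
  show "?v $ i = 0" if i: "i < 6*l" "i \<notin> {0..<6} \<union> {6*m..<6*m+6}" for i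
  proof -
    have "\<forall>t<6. hexacode_word w 0 0 0 t = 0" unfolding all_less_6 by (simp add: hexacode_word_def)
    moreover have "i div 6 \<noteq> 0" "i div 6 \<noteq> m" using i(2) by auto
    ultimately show ?thesis using i(1) by (simp add: word_def a'_def b'_def c'_def)
  qed
qed

text \<open>In an MDS code of dimension 3 any three coordinates can be prescribed. The proof lists a
  word of weight 4 for each of the ten unordered pairs; the other order follows by symmetry.\<close>

lemma hex_two_zeros:
  assumes "p \<in> {1..<6}" "q \<in> {1..<6}" "p \<noteq> q"
  shows "\<exists>a b c. hexacode_word w a b c 0 \<noteq> 0 \<and> hexacode_word w a b c p = 0 \<and> hexacode_word w a b c q = 0"
proof -
  let ?P = "\<lambda>p q a b c. hexacode_word w a b c 0 \<noteq> 0 \<and> hexacode_word w a b c p = 0 \<and> hexacode_word w a b c q = 0"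
  have "?P 1 2 1 1 1" "?P 1 3 0 (w^2) w" "?P 1 4 w 0 (w^2)" "?P 1 5 (w^2) w 0" "?P 2 3 0 w (w^2)"
    "?P 2 4 (w^2) 0 w" "?P 2 5 w (w^2) 0" "?P 3 4 0 0 1" "?P 3 5 0 1 0" "?P 4 5 1 0 0"
    by (simp_all add: hexacode_word_def w_nonzero F4)
  moreover have "p \<in> {1,2,3,4,5}" "q \<in> {1,2,3,4,5}" using assms by auto
  ultimately show ?thesis using \<open>p \<noteq> q\<close> unfolding insert_iff empty_iff simp_thms
    by (elim disjE; hypsubst) (blast | simp)+
qed

lemma not_lrc_code_below_3:
  assumes l: "l \<ge> 3" and r: "r < 3"
  shows "\<not> lrc_code (6*l) r 4 (mat_kernel (H_mat w l))"
proof
  let ?C = "mat_kernel (H_mat w l)"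
  assume "lrc_code (6*l) r 4 ?C"
  then have "\<forall>i<6*l. \<exists>R. R \<subseteq> {..<6*l} \<and> i \<in> R \<and> card R \<le> r + 4 - 1 \<and>
      (\<forall>v\<in>?C. (\<exists>i\<in>R. v $ i \<noteq> 0) \<longrightarrow> 4 \<le> card {i \<in> R. v $ i \<noteq> 0})"
    unfolding lrc_code_alt by (rule conjunct2)
  from this[THEN spec, THEN mp, of 0] l obtain R where R: "R \<subseteq> {..<6*l}" "0 \<in> R" "card R \<le> r + 4 - 1"
    and wt: "\<forall>v\<in>?C. (\<exists>i\<in>R. v $ i \<noteq> 0) \<longrightarrow> 4 \<le> card {i \<in> R. v $ i \<noteq> 0}"
    by (elim meta_impE exE conjE) simp_all
  have fin: "finite R" using R(1) finite_subset by blast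
  define B where "B m = R \<inter> {6*m..<6*m+6}" for m
  define S where "S = R \<inter> {1..<6}"
  have finB: "finite (B m)" for m using fin by (simp add: B_def)
  have finS: "finite S" using fin by (simp add: S_def)
  have "card (insert 0 S) + (card (B 1) + card (B 2)) = card (insert 0 S \<union> (B 1 \<union> B 2))"
    using finB finS by (subst card_Un_disjoint; (subst card_Un_disjoint)?) (auto simp: B_def S_def)
  also have "\<dots> \<le> card R" using R(2) by (intro card_mono fin) (auto simp: B_def S_def)
  finally have "card S + 1 + (card (B 1) + card (B 2)) \<le> 5"
    using R(3) r finS by (simp add: S_def)
  then obtain m where m: "0 < m" "m < l" and cm: "card S + 2 * card (B m) \<le> 4"
    using l by (cases "card (B 1) \<le> card (B 2)") (auto intro: that[of 1] that[of 2])
  \<comment> \<open>\<open>Z\<close> holds the two coordinates where the word is to vanish, chosen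
    to remove as much of \<open>S\<close> as possible. The truncated subtraction covers the case
    where \<open>S\<close> has fewer than two elements.\<close>
  obtain Z where Z: "Z \<subseteq> {1..<6}" "card Z = 2" "card (S - Z) \<le> card S - 2"
  proof (cases "card S \<le> 2")
    case True
    then obtain Z where "S \<subseteq> Z" "Z \<subseteq> {1..<6}" "card Z = 2"
      using exists_subset_between[of S 2 "{1..<6}"] by (auto simp: S_def)
    moreover from this have "card (S - Z) = 0" by (metis Diff_eq_empty_iff card.empty)
    ultimately show thesis using that by simp
  next
    case False
    then obtain Z where Z: "Z \<subseteq> S" "card Z = 2" "finite Z"
      using obtain_subset_with_card_n[of 2 S] by auto
    then show thesis using that[of Z] by (auto simp: S_def card_Diff_subset)
  qed
  from Z(2) obtain p q where pq: "Z = {p, q}" "p \<noteq> q" by (auto simp: card_2_iff)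
  then obtain a b c where abc: "hexacode_word w a b c 0 \<noteq> 0" "hexacode_word w a b c p = 0" "hexacode_word w a b c q = 0"
    using hex_two_zeros[of p q] Z(1) by auto
  obtain v where v: "v \<in> ?C" "\<forall>t<6. v $ t = hexacode_word w a b c t"
    "\<forall>i<6*l. i \<notin> {0..<6} \<union> {6*m..<6*m+6} \<longrightarrow> v $ i = 0"
    using two_block_word[OF m, of a b c] by blast
  have "v $ 0 \<noteq> 0" using v(2) abc(1) by simp
  with R(2) have "4 \<le> card {i \<in> R. v $ i \<noteq> 0}" by (intro wt[rule_format, OF v(1)]) auto
  \<comment> \<open>What survives on \<open>R\<close> is coordinate 0, the part of \<open>S\<close>
    outside \<open>Z\<close>, and \<open>B m\<close>. If \<open>card S\<close> is at most 2, this
    leaves at most 1 + 0 + 2 coordinates; otherwise at most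
    \<open>1 + (card S - 2) + card (B m)\<close>, which \<open>cm\<close> also bounds by 3.\<close>
  also have "\<dots> \<le> card (insert 0 ((S - Z) \<union> B m))"
  proof (intro card_mono subsetI)
    fix i assume "i \<in> {i \<in> R. v $ i \<noteq> 0}"
    then have i: "i \<in> R" "v $ i \<noteq> 0" by auto
    then have "i \<in> {0..<6} \<or> i \<in> B m" using v(3) R(1) by (auto simp: B_def)
    moreover have "i \<notin> Z" using i(2) v(2) abc(2,3) Z(1) pq(1) by auto
    ultimately show "i \<in> insert 0 ((S - Z) \<union> B m)" using i(1) by (auto simp: S_def)
  qed (use finS finB in auto)
  also have "\<dots> \<le> Suc (card (S - Z) + card (B m))"
    using card_insert_le_m1[of "Suc (card (S - Z) + card (B m))" "(S - Z) \<union> B m" 0] card_Un_le[of "S - Z" "B m"]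
    by simp
  finally show False using Z(3) cm by linarith
qed

section \<open>Locality of the code\<close>

lemma lrc_code_kernel:
  assumes C: "linear_code (6*l) (mat_kernel (H_mat w l))"
  shows "lrc_code (6*l) 3 4 (mat_kernel (H_mat w l))"
  unfolding lrc_code_alt
proof (intro conjI C allI impI)
  fix i assume i: "i < 6*l"
  define j where "j = i div 6"
  have j: "j < l" "i \<in> {6*j..<6*j+6}" using i by (auto simp: j_def)
  show "\<exists>R. R \<subseteq> {..<6*l} \<and> i \<in> R \<and> card R \<le> 3 + 4 - 1 \<and>
      (\<forall>v\<in>mat_kernel (H_mat w l). (\<exists>i\<in>R. v $ i \<noteq> 0) \<longrightarrow> 4 \<le> card {i \<in> R. v $ i \<noteq> 0})"
    using j kernel_block_weight_ge[OF _ j(1)]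
    by (intro exI[of _ "{6*j..<6*j+6}"] conjI ballI impI) auto
qed

end

theorem mainTheorem14:
  fixes w :: "'a::field" and l :: nat
  assumes "CARD('a) = 4"
    and "w^2 = w + 1"
    and "l \<ge> 3"
  shows "optimal_lrc_code (6 * l) (3 * l - 2) 6 3 4 (mat_kernel (H_mat w l))"
proof -
  interpret quaternary_field w using assms(1,2) by unfold_locales
  interpret V: vec_space "TYPE('a)" "6*l" .
  let ?C = "mat_kernel (H_mat w l)"
  have l: "l > 0" using assms(3) by simp
  have surj: "\<exists>v \<in> carrier_vec (6*l). H_mat w l *\<^sub>v v = y" if "y \<in> carrier_vec (3*l+2)" for y
    using H_mat_surj[OF that l] .
  have lin: "linear_code (6*l) ?C"
    unfolding linear_code_def by (rule V.mat_kernel_dim_surj(2)[OF H_mat_carrier surj])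
  have "code_dim (6*l) ?C = 6*l - (3*l+2)"
    unfolding code_dim_def by (rule V.mat_kernel_dim_surj(1)[OF H_mat_carrier surj])
  then have dim: "code_dim (6*l) ?C = 3*l - 2" by simp
  obtain v where v: "v \<in> ?C" "hamming_weight v = 6" using ex_word_weight_6[OF l] by blast
  then have "v \<noteq> 0\<^sub>v (6*l)" using hamming_weight_eq_0_iff[of v] by auto
  with v have dist: "min_distance ?C = 6"
    by (intro min_distance_linear[OF lin kernel_weight_ge])
  \<comment> \<open>The quotient is \<open>l - 2/3\<close>, hence strictly above
    \<open>l - 1\<close>. The bound becomes \<open>6*l - (3*l-2) + 1 - 3*(l-1) = 6\<close>.\<close>
  have "\<lceil>real (3*l - 2) / real 3\<rceil> = int l"
    using assms(3) by (intro ceiling_unique) (auto simp: of_nat_diff field_simps)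
  then have "d_optimal (6*l) (3*l - 2) 6 3 4"
    using assms(3) unfolding d_optimal_def by (simp add: of_nat_diff)
  moreover have "r_optimal (6*l) 3 4 ?C"
    unfolding r_optimal_def using not_lrc_code_below_3[OF assms(3)] by blast
  ultimately show ?thesis
    using lin dim dist lrc_code_kernel[OF lin] assms(3)
    unfolding optimal_lrc_code_def nkd_code_def by auto
qed

end
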